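(* Let $n\ge1$ and $s>0$. Then there exists a constant $c(s)>0$ such that for all $f,g\in\ell^2(\mathbb{Z}^n)$, $$\left\||m|^sV_gf\right\|_{L^2(\mathbb{Z}^n\times\mathbb{T}^n)}^2+\left\||w|^sV_gf\right\|_{L^2(\mathbb{Z}^n\times\mathbb{T}^n)}^2\ge c(s)\,\|f\|_{\ell^2(\mathbb{Z}^n)}^2\,\|g\|_{\ell^2(\mathbb{Z}^n)}^2.$$
   Context: For $f,g\in\ell^2(\mathbb{Z}^n)$ the short-time Fourier transform (STFT) of $f$ with window $g$ is the function on $\mathbb{Z}^n\times\mathbb{T}^n$ given by $V_gf(m,w)=\sum_{k\in\mathbb{Z}^n}f(k)\,\overline{g(k-m)}\,e^{-2\pi i w\cdot k}$. $L^2(\mathbb{Z}^n\times\mathbb{T}^n)$ is taken with respect to the product of counting measure on $\mathbb{Z}^n$ and Lebesgue measure on $\mathbb{T}^n$ (total mass $1$). The torus $\mathbb{T}^n=\mathbb{R}^n/\mathbb{Z}^n$ is identified with $[-\tfrac12,\tfrac12)^n$, and $|m|$, $|w|$ are Euclidean norms. $|m|^sV_gf$ and $|w|^sV_gf$ denote the functions $(m,w)\mapsto|m|^sV_gf(m,w)$ and $(m,w)\mapsto|w|^sV_gf(m,w)$; the norms on the left may equal $+\infty$. The dimension $n$ is fixed, so $c(s)$ may depend on $n$. *)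

theory Defs
  imports "HOL-Analysis.Analysis"
begin

definition real_vec :: "int ^ 'n \<Rightarrow> real ^ 'n" where
  "real_vec k = (\<chi> i. real_of_int (k $ i))"

definition ell2 :: "('a \<Rightarrow> complex) set" where
  "ell2 = {f. (\<lambda>k. (cmod (f k))\<^sup>2) summable_on UNIV}"

definition ell2_norm :: "('a \<Rightarrow> complex) \<Rightarrow> real" where
  "ell2_norm f = sqrt (\<Sum>\<^sub>\<infinity>k. (cmod (f k))\<^sup>2)"

text \<open>For \<open>f\<close>, \<open>g\<close> in \<open>ell2\<close> the series below converges absolutely (Cauchy--Schwarz), so the
  unordered sum is never a default value there.\<close>

definition STFT ::
  "(int ^ 'n::finite \<Rightarrow> complex) \<Rightarrow> (int ^ 'n \<Rightarrow> complex) \<Rightarrow> int ^ 'n \<Rightarrow> real ^ 'n \<Rightarrow> complex" where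
  "STFT g f m w = (\<Sum>\<^sub>\<infinity>k. f k * cnj (g (k - m)) * exp (- 2 * pi * \<i> * (w \<bullet> real_vec k)))"

definition torus :: "(real ^ 'n::finite) set" where
  "torus = {w. \<forall>i. - (1/2) \<le> w $ i \<and> w $ i < 1/2}"

definition phase_space :: "((int ^ 'n::finite) \<times> (real ^ 'n)) measure" where
  "phase_space = count_space UNIV \<Otimes>\<^sub>M restrict_space lborel torus"

text \<open>The \<open>L\<^sup>2\<close> norm with values in the extended half-line: it is \<open>\<infinity>\<close> for measurable functions
  that are not square integrable.\<close>

definition L2_norm :: "'a measure \<Rightarrow> ('a \<Rightarrow> complex) \<Rightarrow> ennreal" where
  "L2_norm M F =
    (let I = (\<integral>\<^sup>+ x. ennreal ((cmod (F x))\<^sup>2) \<partial>M)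
     in if I = \<infinity> then \<infinity> else ennreal (sqrt (enn2real I)))"

end

theory Submission
  imports Defs
begin

text \<open>Write \<open>N\<close> for the product of the squared norms of \<open>f\<close> and \<open>g\<close>. By Parseval on the torus,
  \<open>STFT g f\<close> has total mass \<open>N\<close> on phase space. The mass at \<open>m \<noteq> 0\<close> is controlled by the first term,
  because nonzero lattice points have norm at least \<open>1\<close>, and the mass at \<open>m = 0\<close>, \<open>|w| \<ge> 1/4\<close> by the
  second. The remaining set \<open>{0} \<times> {|w| < 1/4}\<close> has measure at most \<open>1/2\<close>, and the STFT is bounded
  there by \<open>\<surd>N\<close>, so it carries at most half of the mass.\<close>

section \<open>Sums as integrals, and Parseval for absolutely summable coefficients\<close>

text \<open>Links the \<open>summable_on\<close> of the definitions to counting measure, which makes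
  Fubini available for series.\<close>

lemma integrable_count_space_iff_abs_summable:
  fixes h :: "'a \<Rightarrow> 'b::{banach, second_countable_topology}"
  shows "integrable (count_space UNIV) h \<longleftrightarrow> (\<lambda>k. norm (h k)) summable_on UNIV"
  by (simp flip: abs_summable_equivalent Infinite_Set_Sum.abs_summable_on_def)

lemma infsum_eq_integral_count_space:
  fixes h :: "'a \<Rightarrow> 'b::{banach, second_countable_topology}"
  assumes "integrable (count_space UNIV) h"
  shows "(\<Sum>\<^sub>\<infinity>k. h k) = (\<integral>k. h k \<partial>count_space UNIV)"
  using infsetsum_infsum[of h UNIV] assms
  by (simp add: Infinite_Set_Sum.abs_summable_on_def infsetsum_def)

text \<open>Fubini for counting measure times \<open>M\<close>: the integrand is dominated by
  \<open>C * norm (h k)\<close>, which is integrable since \<open>M\<close> is finite. Parseval uses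
  this twice, with the conjugate of a single \<open>e l\<close> and with that of the whole series as
  \<open>\<Phi>\<close>.\<close>

lemma integral_series_mult:
  fixes h :: "'a::countable \<Rightarrow> complex" and e :: "'a \<Rightarrow> 'b \<Rightarrow> complex"
  assumes M: "finite_measure M"
    and h: "integrable (count_space UNIV) h"
    and e [measurable]: "\<And>k. e k \<in> borel_measurable M"
    and e_le: "\<And>k w. norm (e k w) \<le> 1"
    and \<Phi> [measurable]: "\<Phi> \<in> borel_measurable M"
    and \<Phi>_le: "\<And>w. norm (\<Phi> w) \<le> C"
  shows "(\<integral>w. (\<integral>k. h k * e k w \<partial>count_space UNIV) * \<Phi> w \<partial>M)
    = (\<integral>k. h k * (\<integral>w. e k w * \<Phi> w \<partial>M) \<partial>count_space UNIV)"
proof -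
  interpret finite_measure M by fact
  interpret C: sigma_finite_measure "count_space (UNIV :: 'a set)"
    by (rule sigma_finite_measure_count_space)
  interpret P: pair_sigma_finite "count_space (UNIV :: 'a set)" M ..
  have C: "0 \<le> C" using \<Phi>_le[of undefined] norm_ge_zero order_trans by blast
  have bound: "norm (e k w * \<Phi> w) \<le> C" for k w
    using mult_mono[OF e_le[of k w] \<Phi>_le[of w]] C by (simp add: norm_mult)
  have int: "integrable M (\<lambda>w. e k w * \<Phi> w)" for k
    by (rule integrable_const_bound[where B = C]) (use bound in auto)
  have prod: "integrable (count_space UNIV \<Otimes>\<^sub>M M) (\<lambda>(k, w). h k * (e k w * \<Phi> w))"
  proof (rule P.Fubini_integrable)
    show "(\<lambda>(k, w). h k * (e k w * \<Phi> w)) \<in> borel_measurable (count_space UNIV \<Otimes>\<^sub>M M)"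
      \<comment> \<open>Countability of the index type reduces joint measurability to that of each
        slice.\<close>
      by (rule measurable_pair_measure_countable1) auto
    have le: "(\<integral>w. norm (e k w * \<Phi> w) \<partial>M) \<le> C * measure M (space M)" for k
      using integral_mono[OF integrable_norm[OF int[of k]] integrable_const[of C], OF bound]
      by (simp add: mult.commute)
    have "integrable (count_space UNIV) (\<lambda>k. norm (h k) * (\<integral>w. norm (e k w * \<Phi> w) \<partial>M))"
    proof (rule Bochner_Integration.integrable_bound)
      show "integrable (count_space UNIV) (\<lambda>k. norm (h k) * (C * measure M (space M)))"
        using h by (intro integrable_mult_left integrable_norm)
    qed (use le C in \<open>auto simp: abs_mult abs_of_nonneg integral_nonneg_AE intro!: mult_left_mono\<close>)
    then show "integrable (count_space UNIV)
        (\<lambda>k. \<integral>w. norm (case (k, w) of (k, w) \<Rightarrow> h k * (e k w * \<Phi> w)) \<partial>M)"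
      by (simp add: norm_mult)
  qed (use int in auto)
  have "(\<integral>w. (\<integral>k. h k * e k w \<partial>count_space UNIV) * \<Phi> w \<partial>M)
      = (\<integral>w. (\<integral>k. h k * (e k w * \<Phi> w) \<partial>count_space UNIV) \<partial>M)"
  proof (rule Bochner_Integration.integral_cong)
    fix w
    have "integrable (count_space UNIV) (\<lambda>k. h k * e k w)"
      by (rule Bochner_Integration.integrable_bound[OF h]) (use h e_le in \<open>auto simp: norm_mult mult_left_le\<close>)
    then show "(\<integral>k. h k * e k w \<partial>count_space UNIV) * \<Phi> w
        = (\<integral>k. h k * (e k w * \<Phi> w) \<partial>count_space UNIV)"
      using Bochner_Integration.integral_mult_left[of "\<Phi> w" "count_space UNIV" "\<lambda>k. h k * e k w"]
      by (simp add: mult.assoc)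
  qed simp
  also have "\<dots> = (\<integral>k. (\<integral>w. h k * (e k w * \<Phi> w) \<partial>M) \<partial>count_space UNIV)"
    by (rule P.Fubini_integral[OF prod])
  finally show ?thesis by simp
qed

text \<open>Absolute summability makes \<open>E\<close> a bounded function given pointwise by its
  series. Two termwise integrations then suffice: one recovers the coefficients from orthonormality,
  the other computes the norm.\<close>

lemma parseval_abs_summable:
  fixes h :: "'a::countable \<Rightarrow> complex" and e :: "'a \<Rightarrow> 'b \<Rightarrow> complex"
  assumes M: "finite_measure M"
    and h: "integrable (count_space UNIV) h"
    and e [measurable]: "\<And>k. e k \<in> borel_measurable M"
    and e_le: "\<And>k w. norm (e k w) \<le> 1"
    and orth: "\<And>k l. (\<integral>w. e k w * cnj (e l w) \<partial>M) = of_bool (k = l)"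
  defines "E \<equiv> \<lambda>w. \<integral>k. h k * e k w \<partial>count_space UNIV"
  shows "E \<in> borel_measurable M"
    and "(\<integral>\<^sup>+w. ennreal ((norm (E w))\<^sup>2) \<partial>M) = (\<integral>\<^sup>+k. ennreal ((norm (h k))\<^sup>2) \<partial>count_space UNIV)"
proof -
  interpret finite_measure M by fact
  interpret C: sigma_finite_measure "count_space (UNIV :: 'a set)"
    by (rule sigma_finite_measure_count_space)
  show E [measurable]: "E \<in> borel_measurable M"
    unfolding E_def
  proof (rule C.borel_measurable_lebesgue_integral)
    have "(\<lambda>(k, w). h k * e k w) \<in> borel_measurable (count_space UNIV \<Otimes>\<^sub>M M)"
      by (rule measurable_pair_measure_countable1) auto
    then show "(\<lambda>(w, k). h k * e k w) \<in> borel_measurable (M \<Otimes>\<^sub>M count_space UNIV)"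
      \<comment> \<open>The slice criterion wants the countable coordinate first, whereas
        integrating out \<open>k\<close> wants it second.\<close>
      by (subst measurable_pair_swap_iff) (simp add: case_prod_beta')
  qed
  have cnj_measurable: "(\<lambda>w. cnj (u w)) \<in> borel_measurable M" if "u \<in> borel_measurable M" for u
    using that by (rule borel_measurable_continuous_on[rotated]) (intro continuous_intros)
  define H where "H = (\<integral>k. norm (h k) \<partial>count_space UNIV)"
  have E_le: "norm (E w) \<le> H" for w
  proof -
    have "norm (E w) \<le> (\<integral>k. norm (h k * e k w) \<partial>count_space UNIV)"
      unfolding E_def by (rule integral_norm_bound)
    also have "\<dots> \<le> H"
      unfolding H_def using h e_le
      by (intro integral_mono' integrable_norm) (auto simp: norm_mult mult_left_le)
    finally show ?thesis .
  qed
  \<comment> \<open>Orthonormality leaves only the term \<open>k = l\<close> of the series.\<close>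
  have coeff: "(\<integral>w. E w * cnj (e l w) \<partial>M) = h l" for l
  proof -
    have "(\<integral>w. E w * cnj (e l w) \<partial>M) = (\<integral>k. h k * of_bool (k = l) \<partial>count_space UNIV)"
      unfolding E_def
      by (subst integral_series_mult[OF M h e e_le, where C = 1]) (use e e_le orth cnj_measurable in auto)
    also have "\<dots> = h l"
    proof -
      have "{k. k = l \<and> h k \<noteq> 0} = (if h l = 0 then {} else {l})" by auto
      then show ?thesis by (simp add: lebesgue_integral_count_space_finite_support)
    qed
    finally show ?thesis .
  qed
  \<comment> \<open>Integrate the series termwise against its own conjugate.\<close>
  have "(\<integral>w. E w * cnj (E w) \<partial>M) = (\<integral>k. h k * (\<integral>w. e k w * cnj (E w) \<partial>M) \<partial>count_space UNIV)"
    unfolding E_def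
    by (rule integral_series_mult[OF M h e e_le, where C = H]) (use cnj_measurable[OF E] E_le in \<open>auto simp: E_def\<close>)
  also have "\<dots> = (\<integral>k. h k * cnj (h k) \<partial>count_space UNIV)"
  proof -
    have "(\<integral>w. e k w * cnj (E w) \<partial>M) = cnj (h k)" for k
      using Bochner_Integration.integral_cnj[of M "\<lambda>w. E w * cnj (e k w)"] by (simp add: coeff mult.commute)
    then show ?thesis by simp
  qed
  finally have "complex_of_real (\<integral>w. (norm (E w))\<^sup>2 \<partial>M)
      = complex_of_real (\<integral>k. (norm (h k))\<^sup>2 \<partial>count_space UNIV)"
    by (simp add: complex_norm_square[symmetric] del: of_real_power)
  then have eq: "(\<integral>w. (norm (E w))\<^sup>2 \<partial>M) = (\<integral>k. (norm (h k))\<^sup>2 \<partial>count_space UNIV)"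
    using of_real_eq_iff by blast
  \<comment> \<open>Bounding one factor of the square by \<open>H\<close> shows that summable
    coefficients are square summable. Integrability on both sides is what turns \<open>eq\<close>,
    an identity of Bochner integrals, into one of nonnegative integrals.\<close>
  have h_le: "norm (h k) \<le> H" for k
  proof -
    have "(\<Sum>j\<in>{k}. norm (h j)) \<le> (\<Sum>\<^sub>\<infinity>j. norm (h j))"
      using h by (intro finite_sum_le_infsum) (auto simp: integrable_count_space_iff_abs_summable)
    also have "\<dots> = H"
      unfolding H_def using h by (intro infsum_eq_integral_count_space integrable_norm)
    finally show ?thesis by simp
  qed
  have "integrable (count_space UNIV) (\<lambda>k. (norm (h k))\<^sup>2)"
  proof (rule Bochner_Integration.integrable_bound)
    show "integrable (count_space UNIV) (\<lambda>k. H * norm (h k))"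
      using h by (intro integrable_mult_right integrable_norm)
  qed (use h_le in \<open>auto simp: power2_eq_square intro!: mult_right_mono order_trans[OF _ abs_ge_self]\<close>)
  moreover have "integrable M (\<lambda>w. (norm (E w))\<^sup>2)"
    by (rule integrable_const_bound[where B = "H\<^sup>2"]) (use E_le in \<open>auto intro!: power_mono\<close>)
  ultimately show "(\<integral>\<^sup>+w. ennreal ((norm (E w))\<^sup>2) \<partial>M)
      = (\<integral>\<^sup>+k. ennreal ((norm (h k))\<^sup>2) \<partial>count_space UNIV)"
    by (simp add: nn_integral_eq_integral eq)
qed

section \<open>Orthonormality of the characters of the torus\<close>

text \<open>Lebesgue measure is the image of the product of its one-dimensional copies, so Fubini
  for finite products applies.\<close>

lemma integral_lborel_prod:
  fixes F :: "'a::euclidean_space \<Rightarrow> real \<Rightarrow> complex"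
  assumes F: "\<And>b. b \<in> Basis \<Longrightarrow> integrable lborel (F b)"
  shows "(\<integral>x. (\<Prod>b\<in>Basis. F b (x \<bullet> b)) \<partial>lborel) = (\<Prod>b\<in>Basis. \<integral>x. F b x \<partial>lborel)"
proof -
  interpret product_sigma_finite "\<lambda>_::'a. lborel :: real measure" ..
  have [measurable]: "F b \<in> borel_measurable borel" if "b \<in> Basis" for b
    using F[OF that] by (simp add: borel_measurable_integrable flip: measurable_lborel2)
  have "(\<integral>x. (\<Prod>b\<in>Basis. F b (x \<bullet> b)) \<partial>lborel)
      = (\<integral>y. (\<Prod>b\<in>Basis. F b (y b)) \<partial>(\<Pi>\<^sub>M b\<in>(Basis::'a set). lborel))"
    by (subst lborel_eq, subst integral_distr) auto
  then show ?thesis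
    using product_integral_prod[of Basis F] F by simp
qed

lemma torus_borel [measurable]: "(torus :: (real ^ 'n::finite) set) \<in> sets borel"
  unfolding torus_def by measurable

lemma finite_measure_torus: "finite_measure (restrict_space lborel (torus :: (real ^ 'n::finite) set))"
proof
  have "emeasure lborel (torus :: (real ^ 'n) set) \<le> emeasure lborel (cbox (\<chi> i. - (1/2)) (\<chi> i. 1/2) :: (real ^ 'n) set)"
    proof (rule emeasure_mono)
    show "torus \<subseteq> (cbox (\<chi> i. - (1/2)) (\<chi> i. 1/2) :: (real ^ 'n) set)"
      by (force simp: torus_def mem_box_cart intro: less_imp_le)
  qed simp
  also have "\<dots> < \<infinity>"
    by (simp add: emeasure_lborel_cbox_eq)
  finally show "emeasure (restrict_space lborel (torus :: (real ^ 'n) set))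
      (space (restrict_space lborel torus)) \<noteq> \<infinity>"
    by (simp add: emeasure_restrict_space space_restrict_space)
qed

text \<open>For \<open>j \<noteq> 0\<close> the antiderivative has period 1, so its boundary values
  cancel; for \<open>j = 0\<close> the integrand is the indicator of an interval of length
  1.\<close>

lemma integral_exp_unit_interval:
  fixes j :: int
  defines "F \<equiv> \<lambda>x::real. indicator {-(1/2)..<1/2} x *\<^sub>R exp (- 2 * pi * \<i> * (x * real_of_int j))"
  shows "integrable lborel F" and "(\<integral>x. F x \<partial>lborel) = of_bool (j = 0)"
proof -
  define f where "f = (\<lambda>x::real. exp (- 2 * pi * \<i> * (x * real_of_int j)))"
  define G where "G = (\<lambda>x::real. if j = 0 then of_real x else f x / (- 2 * pi * \<i> * j))"
  have "has_bochner_integral lborel (\<lambda>x. indicator {-(1/2)..1/2} x *\<^sub>R f x) (G (1/2) - G (-(1/2)))"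
  proof (rule has_bochner_integral_FTC_Icc)
    show "(G has_vector_derivative f x) (at x within {-(1/2)..1/2})" for x
    proof (cases "j = 0")
      case True
      then show ?thesis
        by (auto simp: G_def f_def intro!: derivative_eq_intros)
    next
      case False
      have "((\<lambda>z. exp (- 2 * pi * \<i> * (z * j)) / (- 2 * pi * \<i> * j)) has_field_derivative f x)
          (at (complex_of_real x))"
        using False by (auto simp: f_def intro!: derivative_eq_intros)
      then show ?thesis
        using False has_vector_derivative_real_field
        by (fastforce simp: G_def f_def)
    qed
    show "continuous_on {-(1/2)..1/2} f"
      unfolding f_def by (intro continuous_intros)
  qed simp
  moreover have "G (1/2) - G (-(1/2)) = of_bool (j = 0)"
  proof (cases "j = 0")
    case False
    \<comment> \<open>The endpoints are one full period apart.\<close>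
    have "f (1/2) = f (-(1/2)) * exp (2 * pi * \<i> * of_int (-j))"
      unfolding f_def by (simp flip: exp_add add: algebra_simps)
    also have "exp (2 * pi * \<i> * of_int (-j)) = 1"
      using exp_integer_2pi[of "of_int (-j)"] by (simp add: mult_ac)
    finally show ?thesis using False by (simp add: G_def)
  qed (simp add: G_def)
  \<comment> \<open>The fundamental theorem is applied on the closed interval; the half-open one
    differs by a null set.\<close>
  moreover have "AE x in lborel. indicator {-(1/2)..1/2} x *\<^sub>R f x = F x"
    using AE_lborel_singleton[of "1/2::real"]
    by eventually_elim (auto simp: F_def f_def indicator_def)
  ultimately have "has_bochner_integral lborel F (of_bool (j = 0))"
    by (subst has_bochner_integral_cong_AE[symmetric]) (auto simp: F_def f_def)
  then show "integrable lborel F" "(\<integral>x. F x \<partial>lborel) = of_bool (j = 0)"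
    by (auto simp: has_bochner_integral_iff)
qed

text \<open>Spelled exactly like the exponential factor in \<open>STFT\<close>, negative sign
  included, so that it can be folded there.\<close>

definition torus_char :: "int ^ 'n::finite \<Rightarrow> real ^ 'n \<Rightarrow> complex" where
  "torus_char k w = exp (- 2 * pi * \<i> * (w \<bullet> real_vec k))"

lemma norm_torus_char [simp]: "norm (torus_char k w) = 1"
  by (simp add: torus_char_def norm_exp_eq_Re)

lemma torus_char_measurable [measurable]: "torus_char k \<in> borel_measurable borel"
  unfolding torus_char_def by measurable

text \<open>Both the indicator of the cube and the character are products over the coordinates,
  which reduces the claim to dimension one.\<close>

lemma integral_torus_char:
  fixes k :: "int ^ 'n::finite"
  shows
  "(\<integral>w. torus_char k w \<partial>restrict_space lborel torus) = of_bool (k = 0)"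
proof -
  define F where "F = (\<lambda>j (x::real). indicator {-(1/2)..<1/2} x *\<^sub>R exp (- 2 * pi * \<i> * (x * real_of_int j)))"
  have int: "integrable lborel (F j)" "(\<integral>x. F j x \<partial>lborel) = of_bool (j = 0)" for j
    using integral_exp_unit_interval[of j] by (auto simp: F_def)
  have Basis: "(Basis :: (real ^ 'n) set) = range (\<lambda>i. axis i 1)"
    by (auto simp: Basis_vec_def)
  have inj: "inj (\<lambda>i. axis i (1::real) :: real ^ 'n)"
    by (auto simp: inj_def axis_eq_axis)
  \<comment> \<open>The product formula runs over \<open>Basis\<close>, while \<open>k\<close> is
    indexed by coordinates; \<open>ix\<close> translates.\<close>
  define ix where "ix = inv (\<lambda>i. axis i (1::real) :: real ^ 'n)"
  have ix: "ix (axis i 1) = i" for i unfolding ix_def by (rule inv_f_f[OF inj])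
  have "(\<integral>w. torus_char k w \<partial>restrict_space lborel torus)
      = (\<integral>w. indicator torus w *\<^sub>R torus_char k w \<partial>lborel)"
    by (rule integral_restrict_space) simp
  also have "\<dots> = (\<integral>w. (\<Prod>b\<in>Basis. F (k $ ix b) (w \<bullet> b)) \<partial>lborel)"
  proof (rule Bochner_Integration.integral_cong)
    fix w :: "real ^ 'n"
    have "(\<Prod>b\<in>Basis. F (k $ ix b) (w \<bullet> b)) = (\<Prod>i\<in>UNIV. F (k $ i) (w $ i))"
      unfolding Basis by (subst prod.reindex[OF inj]) (simp add: ix inner_axis)
    also have "\<dots> = indicator torus w *\<^sub>R torus_char k w"
    proof (cases "w \<in> torus")
      case True
      then have "(\<Prod>i\<in>UNIV. F (k $ i) (w $ i))
          = (\<Prod>i\<in>UNIV. exp (- 2 * pi * \<i> * (w $ i * real_of_int (k $ i))))"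
        by (intro prod.cong) (auto simp: F_def torus_def)
      also have "\<dots> = torus_char k w"
        by (simp add: torus_char_def real_vec_def inner_vec_def exp_sum sum_distrib_left)
      finally show ?thesis using True by simp
    next
      case False
      then obtain i where "F (k $ i) (w $ i) = 0"
        by (auto simp: torus_def F_def indicator_def)
      then show ?thesis using False by (auto intro!: prod_zero)
    qed
    finally show "indicator torus w *\<^sub>R torus_char k w = (\<Prod>b\<in>Basis. F (k $ ix b) (w \<bullet> b))" ..
  qed simp
  also have "\<dots> = (\<Prod>b\<in>Basis. \<integral>x. F (k $ ix b) x \<partial>lborel)"
    by (rule integral_lborel_prod) (rule int)
  also have "\<dots> = (\<Prod>i\<in>UNIV. of_bool (k $ i = 0))"
    unfolding Basis by (subst prod.reindex[OF inj]) (simp add: ix int)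
  also have "\<dots> = of_bool (k = 0)"
    by (auto simp: vec_eq_iff)
  finally show ?thesis .
qed

lemma torus_char_orthonormal:
  "(\<integral>w. torus_char k w * cnj (torus_char l w) \<partial>restrict_space lborel torus) = of_bool (k = l)"
proof -
  have "torus_char k w * cnj (torus_char l w) = torus_char (k - l) w" for w
    by (simp add: torus_char_def exp_cnj inner_vec_def real_vec_def sum_subtractf
        algebra_simps flip: exp_add)
  then show ?thesis by (simp add: integral_torus_char)
qed


section \<open>Square-summable sequences\<close>

text \<open>Cauchy-Schwarz on finite sets has a bound independent of the set, which yields
  summability and the estimate at once.\<close>

lemma ell2_Cauchy_Schwarz:
  fixes f g :: "'a \<Rightarrow> complex"
  assumes f: "f \<in> ell2" and g: "g \<in> ell2"
  shows "(\<lambda>k. norm (f k * cnj (g k))) summable_on UNIV"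
    and "(\<Sum>\<^sub>\<infinity>k. norm (f k * cnj (g k))) \<le> ell2_norm f * ell2_norm g"
proof -
  have L2: "L2_set (\<lambda>k. norm (u k)) F \<le> ell2_norm u" if "u \<in> ell2" "finite F" for u :: "'a \<Rightarrow> complex" and F
    unfolding L2_set_def ell2_norm_def using that
    by (intro real_sqrt_le_mono finite_sum_le_infsum) (auto simp: ell2_def)
  have le: "(\<Sum>k\<in>F. norm (f k * cnj (g k))) \<le> ell2_norm f * ell2_norm g" if "finite F" for F
  proof -
    have "(\<Sum>k\<in>F. norm (f k * cnj (g k))) \<le> L2_set (\<lambda>k. norm (f k)) F * L2_set (\<lambda>k. norm (g k)) F"
      using L2_set_mult_ineq[of "\<lambda>k. norm (f k)" "\<lambda>k. norm (g k)" F] by (simp add: norm_mult)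
    also have "\<dots> \<le> ell2_norm f * ell2_norm g"
      using L2 f g that by (intro mult_mono) (auto simp: ell2_norm_def infsum_nonneg)
    finally show ?thesis .
  qed
  show sum: "(\<lambda>k. norm (f k * cnj (g k))) summable_on UNIV"
    using le by (intro nonneg_bdd_above_summable_on) (auto simp: bdd_above_def)
  show "(\<Sum>\<^sub>\<infinity>k. norm (f k * cnj (g k))) \<le> ell2_norm f * ell2_norm g"
    using le by (intro infsum_le_finite_sums[OF sum]) auto
qed

lemma ell2_shift:
  fixes g :: "'a::ab_group_add \<Rightarrow> complex"
  assumes "g \<in> ell2"
  shows "(\<lambda>k. g (k - m)) \<in> ell2"
proof -
  have "bij_betw (\<lambda>k. k - m) UNIV UNIV"
    by (rule bij_betw_byWitness[where f' = "\<lambda>k. k + m"]) auto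
  then show ?thesis
    using assms unfolding ell2_def
    by (simp add: summable_on_reindex_bij_betw[where f = "\<lambda>k. (norm (g k))\<^sup>2"])
qed

lemma nn_integral_ell2:
  assumes "f \<in> ell2"
  shows "(\<integral>\<^sup>+k. ennreal ((norm (f k))\<^sup>2) \<partial>count_space UNIV) = ennreal ((ell2_norm f)\<^sup>2)"
proof -
  have int: "integrable (count_space UNIV) (\<lambda>k. (norm (f k))\<^sup>2)"
    using assms by (simp add: integrable_count_space_iff_abs_summable ell2_def)
  then have "(\<integral>\<^sup>+k. ennreal ((norm (f k))\<^sup>2) \<partial>count_space UNIV) = ennreal (\<Sum>\<^sub>\<infinity>k. (norm (f k))\<^sup>2)"
    by (simp add: nn_integral_eq_integral infsum_eq_integral_count_space)
  then show ?thesis by (simp add: ell2_norm_def infsum_nonneg)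
qed

section \<open>The STFT as a Fourier series in \<open>w\<close>, and its total mass\<close>

text \<open>For fixed \<open>m\<close> the STFT is a Fourier series whose coefficients are
  absolutely summable by Cauchy-Schwarz, as Parseval above requires.\<close>

lemma STFT_altdef:
  fixes f g :: "int ^ 'n::finite \<Rightarrow> complex"
  assumes "f \<in> ell2" "g \<in> ell2"
  shows "integrable (count_space UNIV) (\<lambda>k. f k * cnj (g (k - m)))" (is ?int)
    and "STFT g f m w = (\<integral>k. f k * cnj (g (k - m)) * torus_char k w \<partial>count_space UNIV)" (is ?eq)
proof -
  show int: ?int
    using ell2_Cauchy_Schwarz(1)[OF assms(1) ell2_shift[OF assms(2)]]
    by (simp add: integrable_count_space_iff_abs_summable)
  have "integrable (count_space UNIV) (\<lambda>k. f k * cnj (g (k - m)) * torus_char k w)"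
    by (rule Bochner_Integration.integrable_bound[OF int]) (auto simp: norm_mult)
  then show ?eq
    by (simp only: STFT_def infsum_eq_integral_count_space flip: torus_char_def)
qed

text \<open>Characters have modulus 1, so Cauchy-Schwarz bounds the series uniformly in
  \<open>w\<close>. This controls the piece of phase space near the origin.\<close>

lemma norm_STFT_0_le:
  fixes f g :: "int ^ 'n::finite \<Rightarrow> complex"
  assumes "f \<in> ell2" "g \<in> ell2"
  shows "norm (STFT g f 0 w) \<le> ell2_norm f * ell2_norm g"
proof -
  have "norm (STFT g f 0 w) \<le> (\<integral>k. norm (f k * cnj (g (k - 0)) * torus_char k w) \<partial>count_space UNIV)"
    unfolding STFT_altdef(2)[OF assms] by (rule integral_norm_bound)
  also have "\<dots> = (\<integral>k. norm (f k * cnj (g k)) \<partial>count_space UNIV)"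
    by (simp add: norm_mult)
  also have "\<dots> = (\<Sum>\<^sub>\<infinity>k. norm (f k * cnj (g k)))"
    using STFT_altdef(1)[OF assms, of 0]
    by (intro infsum_eq_integral_count_space[symmetric] integrable_norm) simp
  also have "\<dots> \<le> ell2_norm f * ell2_norm g"
    by (rule ell2_Cauchy_Schwarz(2)[OF assms])
  finally show ?thesis .
qed

lemma STFT_parseval:
  fixes f g :: "int ^ 'n::finite \<Rightarrow> complex"
  assumes "f \<in> ell2" "g \<in> ell2"
  shows "STFT g f m \<in> borel_measurable (restrict_space lborel torus)"
    and "(\<integral>\<^sup>+w. ennreal ((norm (STFT g f m w))\<^sup>2) \<partial>restrict_space lborel torus)
      = (\<integral>\<^sup>+k. ennreal ((norm (f k))\<^sup>2 * (norm (g (k - m)))\<^sup>2) \<partial>count_space UNIV)"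
proof -
  have meas: "torus_char k \<in> borel_measurable (restrict_space lborel torus)" for k :: "int ^ 'n"
    by (rule measurable_restrict_space1) simp
  note parseval = parseval_abs_summable[OF finite_measure_torus STFT_altdef(1)[OF assms, of m] meas,
      OF _ torus_char_orthonormal]
  have eq: "STFT g f m = (\<lambda>w. \<integral>k. f k * cnj (g (k - m)) * torus_char k w \<partial>count_space UNIV)"
    by (rule ext) (rule STFT_altdef(2)[OF assms])
  show "STFT g f m \<in> borel_measurable (restrict_space lborel torus)"
    unfolding eq by (rule parseval(1)) simp
  show "(\<integral>\<^sup>+w. ennreal ((norm (STFT g f m w))\<^sup>2) \<partial>restrict_space lborel torus)
      = (\<integral>\<^sup>+k. ennreal ((norm (f k))\<^sup>2 * (norm (g (k - m)))\<^sup>2) \<partial>count_space UNIV)"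
    unfolding eq by (subst parseval(2)) (simp_all add: norm_mult power_mult_distrib)
qed

lemma STFT_measurable [measurable]:
  assumes "f \<in> ell2" "g \<in> ell2"
  shows "(\<lambda>(m, w). STFT g f m w) \<in> borel_measurable phase_space"
  unfolding phase_space_def
  by (rule measurable_pair_measure_countable1) (use assms in \<open>auto intro: STFT_parseval(1)\<close>)

text \<open>Parseval in \<open>w\<close> for each \<open>m\<close>, then Tonelli: with
  \<open>k\<close> fixed, summing over \<open>m\<close> gives the full mass of
  \<open>g\<close>.\<close>

lemma STFT_isometry:
  fixes f g :: "int ^ 'n::finite \<Rightarrow> complex"
  assumes f: "f \<in> ell2" and g: "g \<in> ell2"
  shows "(\<integral>\<^sup>+(m, w). ennreal ((norm (STFT g f m w))\<^sup>2) \<partial>phase_space)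
    = ennreal ((ell2_norm f)\<^sup>2 * (ell2_norm g)\<^sup>2)"
proof -
  interpret T: finite_measure "restrict_space lborel (torus :: (real ^ 'n) set)"
    by (rule finite_measure_torus)
  have "(\<lambda>(m, w). ennreal ((norm (STFT g f m w))\<^sup>2)) \<in> borel_measurable phase_space"
    using STFT_measurable[OF f g] by (simp add: case_prod_beta')
  then have "(\<integral>\<^sup>+(m, w). ennreal ((norm (STFT g f m w))\<^sup>2) \<partial>phase_space)
      = (\<integral>\<^sup>+m. \<integral>\<^sup>+w. ennreal ((norm (STFT g f m w))\<^sup>2) \<partial>restrict_space lborel torus \<partial>count_space UNIV)"
    unfolding phase_space_def by (subst T.nn_integral_fst[symmetric]) auto
  also have "\<dots> = (\<integral>\<^sup>+m. \<integral>\<^sup>+k. ennreal ((norm (f k))\<^sup>2 * (norm (g (k - m)))\<^sup>2)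
      \<partial>count_space UNIV \<partial>count_space UNIV)"
    by (simp add: STFT_parseval(2)[OF f g])
  also have "\<dots> = (\<integral>\<^sup>+k. \<integral>\<^sup>+m. ennreal ((norm (f k))\<^sup>2 * (norm (g (k - m)))\<^sup>2)
      \<partial>count_space UNIV \<partial>count_space UNIV)"
    using nn_integral_fst_count_space[of "\<lambda>(m, k). ennreal ((norm (f k))\<^sup>2 * (norm (g (k - m)))\<^sup>2)"]
      nn_integral_snd_count_space[of "\<lambda>(m, k). ennreal ((norm (f k))\<^sup>2 * (norm (g (k - m)))\<^sup>2)"]
    by simp
  also have "\<dots> = (\<integral>\<^sup>+k. ennreal ((norm (f k))\<^sup>2) * ennreal ((ell2_norm g)\<^sup>2) \<partial>count_space UNIV)"
  proof (rule nn_integral_cong)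
    fix k :: "int ^ 'n"
    \<comment> \<open>The reflection \<open>m\<close> to \<open>k - m\<close> is its own
      inverse.\<close>
    have "bij_betw (\<lambda>m. k - m) UNIV UNIV"
      by (rule bij_betw_byWitness[where f' = "\<lambda>m. k - m"]) (simp_all add: diff_diff_eq2)
    then have "(\<integral>\<^sup>+m. ennreal ((norm (g (k - m)))\<^sup>2) \<partial>count_space UNIV) = ennreal ((ell2_norm g)\<^sup>2)"
      by (simp add: nn_integral_bij_count_space[where f = "\<lambda>m. ennreal ((norm (g m))\<^sup>2)"]
          nn_integral_ell2[OF g])
    then show "(\<integral>\<^sup>+m. ennreal ((norm (f k))\<^sup>2 * (norm (g (k - m)))\<^sup>2) \<partial>count_space UNIV)
        = ennreal ((norm (f k))\<^sup>2) * ennreal ((ell2_norm g)\<^sup>2)"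
      by (simp add: ennreal_mult nn_integral_cmult)
  qed
  also have "\<dots> = ennreal ((ell2_norm f)\<^sup>2 * (ell2_norm g)\<^sup>2)"
    by (simp add: nn_integral_multc nn_integral_ell2[OF f] ennreal_mult)
  finally show ?thesis .
qed

section \<open>Squared norms, lattice points and the small ball\<close>

text \<open>Squaring undoes the root in the finite case and keeps infinity, so the theorem becomes a
  statement about nonnegative integrals.\<close>

lemma L2_norm_squared:
  "(L2_norm M F)\<^sup>2 = (\<integral>\<^sup>+x. ennreal ((norm (F x))\<^sup>2) \<partial>M)"
  by (cases "\<integral>\<^sup>+x. ennreal ((norm (F x))\<^sup>2) \<partial>M")
    (simp_all add: L2_norm_def ennreal_power)

text \<open>Some coordinate is a nonzero integer.\<close>

lemma norm_real_vec_ge_1: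
  fixes m :: "int ^ 'n::finite"
  assumes "m \<noteq> 0"
  shows "1 \<le> norm (real_vec m)"
proof -
  obtain i where "m $ i \<noteq> 0" using assms by (auto simp: vec_eq_iff)
  then have "1 \<le> \<bar>real_vec m $ i\<bar>" by (simp add: real_vec_def flip: of_int_abs)
  also have "\<dots> \<le> norm (real_vec m)" by (rule component_le_norm_cart)
  finally show ?thesis .
qed

text \<open>The ball sits in a cube of side 1/2, of volume at most 1/2 because the dimension is at
  least 1.\<close>

lemma emeasure_torus_ball_le:
  "emeasure (restrict_space lborel (torus :: (real ^ 'n::finite) set)) (ball 0 (1/4) \<inter> torus) \<le> ennreal (1/2)"
proof -
  have "emeasure (restrict_space lborel torus) (ball 0 (1/4) \<inter> torus :: (real ^ 'n) set)
      = emeasure lborel (ball 0 (1/4) \<inter> torus :: (real ^ 'n) set)"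
    by (subst emeasure_restrict_space) auto
  also have "\<dots> \<le> emeasure lborel (cbox (\<chi> i. - (1/4)) (\<chi> i. 1/4) :: (real ^ 'n) set)"
  proof (rule emeasure_mono)
    show "ball 0 (1/4) \<inter> torus \<subseteq> (cbox (\<chi> i. - (1/4)) (\<chi> i. 1/4) :: (real ^ 'n) set)"
    proof
      fix w :: "real ^ 'n" assume "w \<in> ball 0 (1/4) \<inter> torus"
      then have "\<bar>w $ i\<bar> \<le> 1/4" for i
        using component_le_norm_cart[of w i] by simp
      then show "w \<in> cbox (\<chi> i. - (1/4)) (\<chi> i. 1/4)"
        unfolding mem_box_cart by (simp only: vec_lambda_beta abs_le_iff) (metis minus_le_iff)
    qed
  qed simp
  also have "\<dots> = ennreal ((1/2) ^ CARD('n))"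
    proof -
    have "((\<chi> i. 1/4) - (\<chi> i. - (1/4)) :: real ^ 'n) \<bullet> b = 1/2" if "b \<in> Basis" for b
      using that by (auto simp: Basis_vec_def inner_axis)
    then have "(\<Prod>b\<in>Basis. ((\<chi> i. 1/4) - (\<chi> i. - (1/4)) :: real ^ 'n) \<bullet> b) = (\<Prod>b\<in>(Basis :: (real ^ 'n) set). 1/2)"
      by (intro prod.cong refl)
    then show ?thesis
      by (subst emeasure_lborel_cbox) (force simp: Basis_vec_def inner_axis, simp)
  qed
  also have "\<dots> \<le> ennreal (1/2)"
    using power_decreasing[of 1 "CARD('n)" "1/2 :: real"] by (intro ennreal_leI) simp
  finally show ?thesis .
qed

section \<open>Splitting phase space and absorbing the central piece\<close>

theorem theorem3p16:
  fixes s :: real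
  assumes "s > 0"
  shows "\<exists>c>0. \<forall>f\<in>ell2. \<forall>g\<in>(ell2 :: (int ^ 'n::finite \<Rightarrow> complex) set).
    (L2_norm phase_space (\<lambda>(m, w). of_real (norm (real_vec m) powr s) * STFT g f m w))\<^sup>2
    + (L2_norm phase_space (\<lambda>(m, w). of_real (norm w powr s) * STFT g f m w))\<^sup>2
    \<ge> ennreal (c * (ell2_norm f)\<^sup>2 * (ell2_norm g)\<^sup>2)"
proof (intro exI conjI ballI)
  \<comment> \<open>\<open>K\<close> normalises the weight on \<open>1/4 \<le> norm w\<close>, where
    \<open>K * (norm w powr s)\<^sup>2\<close> is at least 1. As \<open>1 \<le> K\<close>, it also
    serves for \<open>m \<noteq> 0\<close>.\<close>
  define K :: real where "K = (4 powr s)\<^sup>2"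
  have K: "1 \<le> K" using assms by (simp add: K_def ge_one_powr_ge_zero)
  \<comment> \<open>The 2 comes from absorbing the half of \<open>N\<close> carried by the central
    piece.\<close>
  show "0 < 1 / (2 * K)" using K by simp
  fix f g :: "int ^ 'n \<Rightarrow> complex"
  assume f: "f \<in> ell2" and g: "g \<in> ell2"
  interpret T: finite_measure "restrict_space lborel (torus :: (real ^ 'n) set)"
    by (rule finite_measure_torus)
  define N where "N = (ell2_norm f)\<^sup>2 * (ell2_norm g)\<^sup>2"
  \<comment> \<open>Cutting with \<open>torus\<close> keeps \<open>S\<close> inside the space of
    \<open>phase_space\<close>, hence measurable there.\<close>
  define S :: "((int ^ 'n) \<times> (real ^ 'n)) set" where "S = {0} \<times> (ball 0 (1/4) \<inter> torus)"
  define a where "a = (\<lambda>(m, w). (norm (of_real (norm (real_vec m) powr s) * STFT g f m w))\<^sup>2)"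
  define b where "b = (\<lambda>(m, w). (norm (of_real (norm w powr s) * STFT g f m w))\<^sup>2)"
  define A where "A = (\<integral>\<^sup>+x. ennreal (a x) \<partial>phase_space)"
  define B where "B = (\<integral>\<^sup>+x. ennreal (b x) \<partial>phase_space)"
  note [measurable] = STFT_measurable[OF f g]
  have N: "0 \<le> N" by (simp add: N_def)
  have meas_fst: "(\<lambda>x. norm (real_vec (fst x)) powr s) \<in> borel_measurable (phase_space :: ((int ^ 'n) \<times> (real ^ 'n)) measure)"
    unfolding phase_space_def
    by (rule measurable_compose[OF measurable_fst]) simp
  have meas_snd: "(\<lambda>x. norm (snd x) powr s) \<in> borel_measurable (phase_space :: ((int ^ 'n) \<times> (real ^ 'n)) measure)"
    unfolding phase_space_def
    by (rule measurable_compose[OF measurable_snd], rule measurable_restrict_space1) simp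
  have [measurable]: "a \<in> borel_measurable phase_space" "b \<in> borel_measurable phase_space"
    using meas_fst meas_snd STFT_measurable[OF f g] unfolding a_def b_def case_prod_beta' by measurable
  have ball: "ball 0 (1/4) \<inter> torus \<in> sets (restrict_space lborel (torus :: (real ^ 'n) set))"
    by (auto simp: sets_restrict_space)
  then have [measurable]: "S \<in> sets phase_space"
    unfolding S_def phase_space_def by (intro pair_measureI) auto
  have S_le: "emeasure phase_space S \<le> ennreal (1/2)"
    unfolding S_def phase_space_def
    by (subst T.emeasure_pair_measure_Times) (use ball emeasure_torus_ball_le in auto)
  \<comment> \<open>In each of the three regions a single summand already dominates, and the other
    two are nonnegative.\<close>
  have pointwise: "(norm (STFT g f m w))\<^sup>2 \<le> K * a (m, w) + K * b (m, w) + N * indicator S (m, w)"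
    if "w \<in> torus" for m w
  proof -
    have nonneg: "0 \<le> K * a (m, w)" "0 \<le> K * b (m, w)" "0 \<le> N * indicator S (m, w)"
      using K N by (auto simp: a_def b_def)
    consider "m \<noteq> 0" | "1/4 \<le> norm w" | "m = 0" "norm w < 1/4" by linarith
    then show ?thesis
    proof cases
      case 1
      then have "1 \<le> norm (real_vec m) powr s"
        using norm_real_vec_ge_1[of m] assms by (simp add: ge_one_powr_ge_zero)
      then have "1 \<le> K * (norm (real_vec m) powr s)\<^sup>2"
        using K mult_mono[of 1 K 1 "(norm (real_vec m) powr s)\<^sup>2"] by simp
      then have "(norm (STFT g f m w))\<^sup>2 \<le> K * a (m, w)"
        using mult_right_mono[of 1 _ "(norm (STFT g f m w))\<^sup>2"]
        by (fastforce simp: a_def norm_mult power_mult_distrib)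
      then show ?thesis using nonneg by linarith
    next
      case 2
      then have "1 \<le> (4 * norm w) powr s"
        using assms by (simp add: ge_one_powr_ge_zero)
      then have "1 \<le> K * (norm w powr s)\<^sup>2"
        by (simp add: K_def powr_mult flip: power_mult_distrib)
      then have "(norm (STFT g f m w))\<^sup>2 \<le> K * b (m, w)"
        using mult_right_mono[of 1 _ "(norm (STFT g f m w))\<^sup>2"]
        by (fastforce simp: b_def norm_mult power_mult_distrib)
      then show ?thesis using nonneg by linarith
    next
      case 3
      then have "(norm (STFT g f m w))\<^sup>2 \<le> N * indicator S (m, w)"
        using that norm_STFT_0_le[OF f g, of w]
        by (auto simp: N_def S_def simp flip: power_mult_distrib intro!: power_mono)
      then show ?thesis using nonneg by linarith
    qed
  qed
  have "ennreal N = (\<integral>\<^sup>+(m, w). ennreal ((norm (STFT g f m w))\<^sup>2) \<partial>phase_space)"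
    using STFT_isometry[OF f g] by (simp add: N_def)
  also have "\<dots> \<le> (\<integral>\<^sup>+x. ennreal K * ennreal (a x) + ennreal K * ennreal (b x) + ennreal N * indicator S x \<partial>phase_space)"
  proof (rule nn_integral_mono)
    fix x :: "(int ^ 'n) \<times> (real ^ 'n)" assume "x \<in> space phase_space"
    then obtain m w where x: "x = (m, w)" and "w \<in> torus"
      by (auto simp: phase_space_def space_pair_measure space_restrict_space)
    then have "ennreal ((norm (STFT g f m w))\<^sup>2)
        \<le> ennreal (K * a (m, w) + K * b (m, w) + N * indicator S (m, w))"
      by (intro ennreal_leI pointwise)
    then show "(case x of (m, w) \<Rightarrow> ennreal ((norm (STFT g f m w))\<^sup>2))
        \<le> ennreal K * ennreal (a x) + ennreal K * ennreal (b x) + ennreal N * indicator S x"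
      using K N by (simp add: x a_def b_def ennreal_mult ennreal_plus flip: ennreal_indicator)
  qed
  also have "\<dots> = ennreal K * A + ennreal K * B + ennreal N * emeasure phase_space S"
    by (simp add: A_def B_def nn_integral_add nn_integral_cmult nn_integral_cmult_indicator)
  also have "\<dots> \<le> ennreal K * (A + B) + ennreal N * ennreal (1/2)"
    using S_le by (auto simp: distrib_left intro!: add_left_mono mult_left_mono)
  finally have main: "ennreal N \<le> ennreal K * (A + B) + ennreal N * ennreal (1/2)" .
  have "ennreal (1 / (2 * K) * N) \<le> A + B"
  \<comment> \<open>An infinite left-hand side is trivial. Otherwise \<open>main\<close> is an
    inequality of reals, where \<open>N * (1/2)\<close> can be subtracted.\<close>
  proof (cases "A + B")
    case (real r)
    then have "ennreal N \<le> ennreal (K * r + N * (1/2))"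
      using main real K N by (simp only: ennreal_mult ennreal_plus mult_nonneg_nonneg)
    then have "N \<le> K * r + N * (1/2)"
      using real K N by (subst (asm) ennreal_le_iff) auto
    then have "1 / (2 * K) * N \<le> r" using K by (simp add: field_simps)
    then show ?thesis using real by (simp add: ennreal_leI)
  next
    case top
    show ?thesis unfolding top by simp
  qed
  moreover have "(L2_norm phase_space (\<lambda>(m, w). of_real (norm (real_vec m) powr s) * STFT g f m w))\<^sup>2 = A"
    "(L2_norm phase_space (\<lambda>(m, w). of_real (norm w powr s) * STFT g f m w))\<^sup>2 = B"
    by (simp_all add: L2_norm_squared A_def B_def a_def b_def case_prod_beta')
  ultimately show "(L2_norm phase_space (\<lambda>(m, w). of_real (norm (real_vec m) powr s) * STFT g f m w))\<^sup>2
      + (L2_norm phase_space (\<lambda>(m, w). of_real (norm w powr s) * STFT g f m w))\<^sup>2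
      \<ge> ennreal (1 / (2 * K) * (ell2_norm f)\<^sup>2 * (ell2_norm g)\<^sup>2)"
    by (simp add: N_def mult.assoc)
qed

end
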